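(* For each integer $t \ge 3$ there exists a constant $C = C(t) > 0$ such that every two-colouring of the edges of the complete graph $K_n$ on $n \ge C$ vertices that is $Cn^{-1/t}$-far from being monochromatic contains an unavoidable $t$-colouring.
   Context: A two-colouring (with colours red and blue) of the edges of $K_n$ is said to be $\delta$-far from being monochromatic if each of the two colours appears on at least $\delta n^2$ edges. An unavoidable $t$-colouring is a two-colouring of the edges of $K_{2t}$ in which the edges of one colour form either a clique on $t$ vertices or two vertex-disjoint cliques on $t$ vertices each, all remaining edges having the other colour. A two-colouring of $K_n$ contains an unavoidable $t$-colouring if there is a set of $2t$ vertices on which the induced colouring is an unavoidable $t$-colouring. *)

theory Defs
  imports Complex_Main "HOL-Library.Ramsey"
begin

text \<open>
  The complete graph on a finite vertex set \<open>V\<close> has the edge set \<open>[V]\<^bsup>2\<^esup>\<close>. A two-colouring of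
  its edges is a function from vertex sets to colours of which only the values on \<open>[V]\<^bsup>2\<^esup>\<close> matter,
  so the same function also represents all the induced colourings.
\<close>

datatype colour = Red | Blue

definition colour_class :: "('a set \<Rightarrow> colour) \<Rightarrow> 'a set \<Rightarrow> colour \<Rightarrow> 'a set set" where
  "colour_class f V k = {e \<in> [V]\<^bsup>2\<^esup>. f e = k}"

definition far_from_monochromatic :: "real \<Rightarrow> 'a set \<Rightarrow> ('a set \<Rightarrow> colour) \<Rightarrow> bool" where
  "far_from_monochromatic \<delta> V f \<longleftrightarrow>
     (\<forall>k. real (card (colour_class f V k)) \<ge> \<delta> * real (card V) ^ 2)"

definition unavoidable_colouring :: "nat \<Rightarrow> 'a set \<Rightarrow> ('a set \<Rightarrow> colour) \<Rightarrow> bool" where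
  "unavoidable_colouring t W f \<longleftrightarrow>
     finite W \<and> card W = 2 * t \<and>
     (\<exists>k. (\<exists>A. A \<subseteq> W \<and> card A = t \<and> colour_class f W k = [A]\<^bsup>2\<^esup>) \<or>
          (\<exists>A B. A \<subseteq> W \<and> B \<subseteq> W \<and> A \<inter> B = {} \<and> card A = t \<and> card B = t \<and>
                 colour_class f W k = [A]\<^bsup>2\<^esup> \<union> [B]\<^bsup>2\<^esup>))"

definition contains_unavoidable :: "nat \<Rightarrow> 'a set \<Rightarrow> ('a set \<Rightarrow> colour) \<Rightarrow> bool" where
  "contains_unavoidable t V f \<longleftrightarrow> (\<exists>W \<subseteq> V. unavoidable_colouring t W f)"

end

theory Submission
  imports Defs
begin

text \<open>
  Dependent random choice: as one colour \<open>k\<close> has at least \<open>C n\<^bsup>2 - 1/t\<^esup>\<close> edges, there is a large set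
  \<open>U\<close> all of whose \<open>t\<close>-subsets have many common \<open>k\<close>-neighbours. If \<open>U\<close> contains a \<open>t\<close>-clique of the
  other colour, this clique and a monochromatic \<open>t\<close>-clique among its common \<open>k\<close>-neighbours form an
  unavoidable colouring. Otherwise \<open>U\<close> contains a large clique of colour \<open>k\<close>, by Ramsey's theorem.
  Hence there are a large red clique and a large blue clique. The edges between them contain
  a monochromatic \<open>K\<^bsub>t,t\<^esub>\<close>, whose vertices again form an unavoidable colouring.
\<close>

section \<open>Gluing two monochromatic cliques\<close>

definition mono_clique :: "('a set \<Rightarrow> colour) \<Rightarrow> colour \<Rightarrow> 'a set \<Rightarrow> bool" where
  "mono_clique f k A \<longleftrightarrow> (\<forall>e \<in> [A]\<^bsup>2\<^esup>. f e = k)"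

definition mono_between :: "('a set \<Rightarrow> colour) \<Rightarrow> colour \<Rightarrow> 'a set \<Rightarrow> 'a set \<Rightarrow> bool" where
  "mono_between f k A B \<longleftrightarrow> (\<forall>a \<in> A. \<forall>b \<in> B. f {a, b} = k)"

text \<open>The condition \<open>u \<noteq> v\<close> is explicit because \<open>f\<close> also has
  a value on the singleton \<open>{v}\<close>, which is no edge.\<close>

definition colour_nbhd :: "('a set \<Rightarrow> colour) \<Rightarrow> 'a set \<Rightarrow> colour \<Rightarrow> 'a \<Rightarrow> 'a set" where
  "colour_nbhd f V k v = {u \<in> V. u \<noteq> v \<and> f {v, u} = k}"

lemma mono_clique_subset: "mono_clique f k A \<Longrightarrow> B \<subseteq> A \<Longrightarrow> mono_clique f k B"
  unfolding mono_clique_def using nsets_mono by blast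

lemma mono_cliqueD: "mono_clique f k A \<Longrightarrow> x \<in> A \<Longrightarrow> y \<in> A \<Longrightarrow> x \<noteq> y \<Longrightarrow> f {x, y} = k"
  unfolding mono_clique_def by simp

lemma colour_neq_trans: "(a :: colour) \<noteq> c \<Longrightarrow> b \<noteq> c \<Longrightarrow> a = b"
  by (metis colour.exhaust)

text \<open>With only two colours, some class has a required form. If \<open>a = c\<close>, then
  \<open>b\<close> differs from both and occurs only inside \<open>B\<close>; the case
  \<open>b = c\<close> is symmetric; otherwise \<open>a = b\<close>, and this colour occurs exactly
  inside \<open>A\<close> and inside \<open>B\<close>. The hypothesis \<open>ne\<close> excludes
  that all three colours coincide.\<close>

lemma unavoidable_colouring_Un:
  assumes fin: "finite A" "finite B" and disj: "A \<inter> B = {}"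
    and card: "card A = t" "card B = t"
    and A: "mono_clique f a A" and B: "mono_clique f b B"
    and AB: "mono_between f c A B" and ne: "a \<noteq> c \<or> b \<noteq> c"
  shows "unavoidable_colouring t (A \<union> B) f"
proof -
  have nsets: "[A \<union> B]\<^bsup>2\<^esup> = [A]\<^bsup>2\<^esup> \<union> [B]\<^bsup>2\<^esup> \<union> {{x, y} |x y. x \<in> A \<and> y \<in> B}"
    (is "_ = ?R")
  proof
    show "[A \<union> B]\<^bsup>2\<^esup> \<subseteq> ?R"
    proof
      fix e assume "e \<in> [A \<union> B]\<^bsup>2\<^esup>"
      then obtain x y where e: "e = {x, y}" and xy: "x \<in> A \<union> B" "y \<in> A \<union> B" "x \<noteq> y"
        by (rule nsets2_E)
      have "e = {y, x}"
        using e by (simp add: insert_commute)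
      from xy consider "x \<in> A" "y \<in> A" | "x \<in> B" "y \<in> B" | "x \<in> A" "y \<in> B" | "x \<in> B" "y \<in> A"
        by blast
      then show "e \<in> ?R"
      proof cases
        case 3
        with e show ?thesis by blast
      next
        case 4
        with \<open>e = {y, x}\<close> show ?thesis by blast
      qed (simp_all add: e xy(3))
    qed
    show "?R \<subseteq> [A \<union> B]\<^bsup>2\<^esup>"
    proof (intro Un_least nsets_mono subsetI)
      fix e assume "e \<in> {{x, y} |x y. x \<in> A \<and> y \<in> B}"
      then obtain x y where "e = {x, y}" "x \<in> A" "y \<in> B" by blast
      then show "e \<in> [A \<union> B]\<^bsup>2\<^esup>"
        using disj by auto
    qed auto
  qed
  have fA: "f e = a" if "e \<in> [A]\<^bsup>2\<^esup>" for e
    using A that by (simp add: mono_clique_def)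
  have fB: "f e = b" if "e \<in> [B]\<^bsup>2\<^esup>" for e
    using B that by (simp add: mono_clique_def)
  have fAB: "f {x, y} = c" if "x \<in> A" "y \<in> B" for x y
    using AB that by (simp add: mono_between_def)
  have "\<exists>k. colour_class f (A \<union> B) k = [A]\<^bsup>2\<^esup> \<or> colour_class f (A \<union> B) k = [B]\<^bsup>2\<^esup> \<or>
    colour_class f (A \<union> B) k = [A]\<^bsup>2\<^esup> \<union> [B]\<^bsup>2\<^esup>"
  proof (cases "a = c")
    case True
    then have "colour_class f (A \<union> B) b = [B]\<^bsup>2\<^esup>"
      using ne fA fB fAB unfolding colour_class_def nsets by auto
    then show ?thesis by blast
  next
    case False
    then have "b = c \<or> a = b"
      using colour_neq_trans by metis
    then show ?thesis
    proof
      assume "b = c"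
      then have "colour_class f (A \<union> B) a = [A]\<^bsup>2\<^esup>"
        using False fA fB fAB unfolding colour_class_def nsets by auto
      then show ?thesis by blast
    next
      assume "a = b"
      then have "colour_class f (A \<union> B) a = [A]\<^bsup>2\<^esup> \<union> [B]\<^bsup>2\<^esup>"
        using False fA fB fAB unfolding colour_class_def nsets by auto
      then show ?thesis by blast
    qed
  qed
  moreover have "A \<subseteq> A \<union> B" "B \<subseteq> A \<union> B" "finite (A \<union> B)" "card (A \<union> B) = 2 * t"
    using fin disj card by (auto simp: card_Un_disjoint)
  ultimately show ?thesis
    unfolding unavoidable_colouring_def using card disj by metis
qed

section \<open>Ramsey numbers for cliques and for complete bipartite graphs\<close>

lemma ramsey_colour:
  "\<exists>N. \<forall>(V :: 'a set) f k. finite V \<longrightarrow> card V \<ge> N \<longrightarrow>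
     (\<exists>A \<subseteq> V. card A = p \<and> mono_clique f k A) \<or>
     (\<exists>A \<subseteq> V. \<exists>j. card A = q \<and> j \<noteq> k \<and> mono_clique f j A)"
proof -
  obtain r where r: "\<And>V :: 'a set. \<And>E. finite V \<Longrightarrow> card V \<ge> r \<Longrightarrow>
      \<exists>R \<subseteq> V. card R = p \<and> clique R E \<or> card R = q \<and> indep R E"
    using ramsey2[of p q] by blast
  have "(\<exists>A \<subseteq> V. card A = p \<and> mono_clique f k A) \<or>
     (\<exists>A \<subseteq> V. \<exists>j. card A = q \<and> j \<noteq> k \<and> mono_clique f j A)"
    if V: "finite V" "card V \<ge> r" for V :: "'a set" and f k
  proof -
    \<comment> \<open>In the graph formed by the edges of colour \<open>k\<close>, an independent
      set avoids \<open>k\<close>, so its edges all have the one remaining colour.\<close>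
    obtain R where R: "R \<subseteq> V"
        "card R = p \<and> clique R {e. f e = k} \<or> card R = q \<and> indep R {e. f e = k}"
      using r[OF V] by blast
    have "mono_clique f k R" if "clique R {e. f e = k}"
      using that by (auto simp: mono_clique_def clique_def nsets_2_eq)
    moreover have "\<exists>j. j \<noteq> k \<and> mono_clique f j R" if "indep R {e. f e = k}"
    proof -
      obtain j where "j \<noteq> k" by (metis colour.distinct(1))
      moreover have "f e = j" if "e \<in> [R]\<^bsup>2\<^esup>" for e
      proof -
        have "f e \<noteq> k"
          using that \<open>indep R _\<close> by (auto simp: indep_def nsets_2_eq)
        then show ?thesis
          using \<open>j \<noteq> k\<close> by (rule colour_neq_trans)
      qed
      ultimately show ?thesis by (auto simp: mono_clique_def)
    qed
    ultimately show ?thesis using R by blast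
  qed
  then show ?thesis by blast
qed

lemma split_finite_linorder:
  fixes H :: "'a :: linorder set"
  assumes "finite H" "card H = p + q"
  obtains A B where "A \<subseteq> H" "B \<subseteq> H" "card A = p" "card B = q" "\<And>a b. a \<in> A \<Longrightarrow> b \<in> B \<Longrightarrow> a < b"
proof
  let ?xs = "sorted_list_of_set H"
  have xs: "set ?xs = H" "length ?xs = p + q" "distinct ?xs" "sorted_wrt (<) ?xs"
    using assms by auto
  show "set (take p ?xs) \<subseteq> H" "set (drop p ?xs) \<subseteq> H"
    using xs(1) set_take_subset set_drop_subset by metis+
  show "card (set (take p ?xs)) = p" "card (set (drop p ?xs)) = q"
    using xs by (simp_all add: distinct_card del: length_sorted_list_of_set)
  show "a < b" if "a \<in> set (take p ?xs)" "b \<in> set (drop p ?xs)" for a b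
    using xs(4) that sorted_wrt_append[of "(<)" "take p ?xs" "drop p ?xs"] by simp
qed

text \<open>Reduction to the Ramsey theorem on indices: enumerate \<open>N\<close> points of each
  side as \<open>x i\<close> and \<open>y j\<close>, and colour a pair \<open>i < j\<close> by
  \<open>f {x i, y j}\<close>. In a homogeneous set of \<open>2 * t\<close> indices, the lower half
  provides the \<open>x\<close> side and the upper half the \<open>y\<close> side.\<close>

lemma bipartite_ramsey:
  "\<exists>N. \<forall>(X :: 'a set) Y f. finite X \<longrightarrow> finite Y \<longrightarrow> card X \<ge> N \<longrightarrow> card Y \<ge> N \<longrightarrow>
     (\<exists>A \<subseteq> X. \<exists>B \<subseteq> Y. \<exists>c. card A = t \<and> card B = t \<and> mono_between f c A B)"
proof -
  obtain N where N: "\<And>(V :: nat set) f k. finite V \<Longrightarrow> card V \<ge> N \<Longrightarrow>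
     (\<exists>A \<subseteq> V. card A = t + t \<and> mono_clique f k A) \<or>
     (\<exists>A \<subseteq> V. \<exists>j. card A = t + t \<and> j \<noteq> k \<and> mono_clique f j A)"
    using ramsey_colour[of "t + t" "t + t"] by blast
  have "\<exists>A \<subseteq> X. \<exists>B \<subseteq> Y. \<exists>c. card A = t \<and> card B = t \<and> mono_between f c A B"
    if XY: "finite X" "finite Y" "card X \<ge> N" "card Y \<ge> N" for X Y :: "'a set" and f
  proof -
    obtain x where x: "inj_on x {..<N}" "x ` {..<N} \<subseteq> X"
      using XY by (metis card_le_inj card_lessThan finite_lessThan)
    obtain y where y: "inj_on y {..<N}" "y ` {..<N} \<subseteq> Y"
      using XY by (metis card_le_inj card_lessThan finite_lessThan)
    \<comment> \<open>\<open>Min\<close> and \<open>Max\<close> turn the unordered pair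
      \<open>e\<close> into an ordered one.\<close>
    define g where "g e = f {x (Min e), y (Max e)}" for e
    obtain H c where H: "H \<subseteq> {..<N}" "card H = t + t" "mono_clique g c H"
      using N[of "{..<N}" g] by (metis card_lessThan finite_lessThan order_refl)
    obtain A B where AB: "A \<subseteq> H" "B \<subseteq> H" "card A = t" "card B = t"
        "\<And>a b. a \<in> A \<Longrightarrow> b \<in> B \<Longrightarrow> a < b"
      using split_finite_linorder[OF _ H(2)] H(1) finite_subset by (metis finite_lessThan)
    have "f {x a, y b} = c" if "a \<in> A" "b \<in> B" for a b
    proof -
      have "a < b" using AB(5) that by blast
      then have "g {a, b} = c"
        using that AB(1,2) H(3) by (intro mono_cliqueD[of g c H]) auto
      with \<open>a < b\<close> show ?thesis by (simp add: g_def max_def min_def)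
    qed
    then have "mono_between f c (x ` A) (y ` B)"
      by (auto simp: mono_between_def)
    moreover have "x ` A \<subseteq> X" "y ` B \<subseteq> Y"
      using AB(1,2) H(1) x(2) y(2) by blast+
    moreover have "inj_on x A" "inj_on y B"
      using AB(1,2) H(1) x(1) y(1) by (meson inj_on_subset order_trans)+
    then have "card (x ` A) = t" "card (y ` B) = t"
      using AB(3,4) by (simp_all add: card_image)
    ultimately show ?thesis by blast
  qed
  then show ?thesis by blast
qed

section \<open>Dependent random choice, by counting\<close>

lemma avoid_nonempty_sets:
  assumes "finite X" "finite \<B>" "\<And>S. S \<in> \<B> \<Longrightarrow> S \<noteq> {}" "q + card \<B> \<le> card X"
  obtains U where "U \<subseteq> X" "card U \<ge> q" "\<And>S. S \<in> \<B> \<Longrightarrow> \<not> S \<subseteq> U"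
proof
  \<comment> \<open>Deleting one chosen point of each set destroys all of them and costs at most
    \<open>card \<B>\<close> points.\<close>
  define h where "h S = (SOME x. x \<in> S)" for S :: "'a set"
  have h: "h S \<in> S" if "S \<in> \<B>" for S
    unfolding h_def using assms(3)[OF that] by (simp add: some_in_eq)
  show "X - h ` \<B> \<subseteq> X" by blast
  have "card X - card (h ` \<B>) \<le> card (X - h ` \<B>)"
    using assms(2) by (simp add: diff_card_le_card_Diff)
  then show "card (X - h ` \<B>) \<ge> q"
    using card_image_le[OF assms(2), of h] assms(4) by linarith
  show "\<not> S \<subseteq> X - h ` \<B>" if "S \<in> \<B>" for S
    using h[OF that] that by blast
qed

text \<open>Expectations over a random \<open>t\<close>-tuple of vertices become sums over all
  tuples. On average, \<open>pool xs\<close> has at least \<open>q + m ^ t\<close> vertices and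
  contains at most \<open>m ^ t\<close> bad \<open>t\<close>-sets, those with fewer than
  \<open>m\<close> common neighbours. Some tuple does at least as well as the average, and deleting
  a point of each bad set from its pool leaves \<open>q\<close> vertices.\<close>

lemma dependent_random_choice:
  fixes N :: "'a \<Rightarrow> 'a set"
  assumes fin: "finite V" and ne: "V \<noteq> {}" and t: "t > 0" and N: "\<And>v. N v \<subseteq> V"
    and deg: "card V ^ t * (q + m ^ t) \<le> (\<Sum>v\<in>V. card (N v) ^ t)"
  obtains U where "U \<subseteq> V" "card U \<ge> q"
    "\<And>S. S \<subseteq> U \<Longrightarrow> card S = t \<Longrightarrow> card {w \<in> V. \<forall>s\<in>S. w \<in> N s} \<ge> m"
proof -
  define common where "common S = {w \<in> V. \<forall>s\<in>S. w \<in> N s}" for S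
  \<comment> \<open>Tuples may repeat entries, so the number of those inside a set \<open>W\<close>
    is exactly \<open>card W ^ t\<close>.\<close>
  define T where "T = {xs. set xs \<subseteq> V \<and> length xs = t}"
  define pool where "pool xs = {v \<in> V. set xs \<subseteq> N v}" for xs
  define Bad where "Bad = {S \<in> [V]\<^bsup>t\<^esup>. card (common S) < m}"
  define bad where "bad xs = {S \<in> Bad. S \<subseteq> pool xs}" for xs
  have finT: "finite T" and cardT: "card T = card V ^ t"
    unfolding T_def using fin by (simp_all add: finite_lists_length_eq card_lists_length_eq)
  have finBad: "finite Bad"
    unfolding Bad_def using fin by (simp add: finite_imp_finite_nsets)
  have tuples: "card {xs \<in> T. set xs \<subseteq> W} = card W ^ t" if "W \<subseteq> V" for W
  proof -
    have "{xs \<in> T. set xs \<subseteq> W} = {xs. set xs \<subseteq> W \<and> length xs = t}"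
      unfolding T_def using that by auto
    then show ?thesis
      using that fin by (simp add: card_lists_length_eq finite_subset)
  qed
  have "(\<Sum>xs\<in>T. card (pool xs)) = (\<Sum>v\<in>V. card {xs \<in> T. set xs \<subseteq> N v})"
    unfolding pool_def using sum.swap_restrict[OF finT fin, of "\<lambda>_ _. 1 :: nat" "\<lambda>xs v. set xs \<subseteq> N v"]
    by simp
  also have "\<dots> = (\<Sum>v\<in>V. card (N v) ^ t)"
    using tuples N by simp
  finally have pool: "(\<Sum>xs\<in>T. card (pool xs)) = (\<Sum>v\<in>V. card (N v) ^ t)" .
  have "(\<Sum>xs\<in>T. card (bad xs)) = (\<Sum>S\<in>Bad. card {xs \<in> T. S \<subseteq> pool xs})"
    unfolding bad_def
    using sum.swap_restrict[OF finT finBad, of "\<lambda>_ _. 1 :: nat" "\<lambda>xs S. S \<subseteq> pool xs"] by simp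
  \<comment> \<open>Both conditions say that every entry \<open>x\<close> of \<open>xs\<close> and
    every \<open>s\<close> in \<open>S\<close> satisfy \<open>x \<in> N s\<close>.\<close>
  also have "\<dots> = (\<Sum>S\<in>Bad. card {xs \<in> T. set xs \<subseteq> common S})"
  proof (intro sum.cong refl arg_cong[where f = card] Collect_cong)
    fix S xs assume "S \<in> Bad"
    then show "xs \<in> T \<and> S \<subseteq> pool xs \<longleftrightarrow> xs \<in> T \<and> set xs \<subseteq> common S"
      by (auto simp: Bad_def nsets_def pool_def common_def T_def)
  qed
  also have "\<dots> = (\<Sum>S\<in>Bad. card (common S) ^ t)"
    by (intro sum.cong refl tuples) (auto simp: common_def)
  also have "\<dots> \<le> (\<Sum>S\<in>Bad. m ^ t)"
    by (intro sum_mono power_mono) (auto simp: Bad_def)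
  \<comment> \<open>There are at most as many \<open>t\<close>-subsets as \<open>t\<close>-tuples,
    so after division by \<open>card T\<close> the bound is \<open>m ^ t\<close>.\<close>
  also have "\<dots> \<le> card V ^ t * m ^ t"
  proof -
    have "card Bad \<le> card ([V]\<^bsup>t\<^esup>)"
      unfolding Bad_def using fin by (intro card_mono) (auto simp: finite_imp_finite_nsets)
    also have "\<dots> \<le> card V ^ t"
      by (cases "t \<le> card V") (simp_all add: binomial_le_pow binomial_eq_0)
    finally show ?thesis by simp
  qed
  finally have bad: "(\<Sum>xs\<in>T. card (bad xs)) \<le> card V ^ t * m ^ t" .
  have "(\<Sum>xs\<in>T. q + card (bad xs)) \<le> (\<Sum>xs\<in>T. card (pool xs))"
    using bad pool deg by (simp add: sum.distrib cardT algebra_simps)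
  moreover have "T \<noteq> {}"
    using cardT fin ne by (auto simp: card_eq_0_iff)
  ultimately obtain xs where xs: "xs \<in> T" "q + card (bad xs) \<le> card (pool xs)"
    using sum_strict_mono[OF finT, of "\<lambda>xs. card (pool xs)" "\<lambda>xs. q + card (bad xs)"]
    by (metis leD leI)
  \<comment> \<open>Bad sets have \<open>t > 0\<close> elements, so each has a point to
    delete.\<close>
  have "finite (pool xs)" "finite (bad xs)" "\<And>S. S \<in> bad xs \<Longrightarrow> S \<noteq> {}"
    using fin finBad t by (auto simp: pool_def bad_def Bad_def nsets_def)
  from avoid_nonempty_sets[OF this xs(2)] obtain U where
    U: "U \<subseteq> pool xs" "card U \<ge> q" "\<And>S. S \<in> bad xs \<Longrightarrow> \<not> S \<subseteq> U" by blast
  have "pool xs \<subseteq> V"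
    by (auto simp: pool_def)
  have "card (common S) \<ge> m" if "S \<subseteq> U" "card S = t" for S
  proof (rule ccontr)
    assume "\<not> m \<le> card (common S)"
    moreover have "S \<in> [V]\<^bsup>t\<^esup>"
      using that U(1) \<open>pool xs \<subseteq> V\<close> t by (auto simp: nsets_def intro: card_ge_0_finite)
    ultimately have "S \<in> bad xs"
      using that(1) U(1) by (auto simp: bad_def Bad_def)
    with U(3) that(1) show False by blast
  qed
  then show thesis
    using that U(1,2) \<open>pool xs \<subseteq> V\<close> unfolding common_def by blast
qed

section \<open>Lower bounds for power sums of degrees\<close>

lemma sum_power_ge:
  fixes x :: "'a \<Rightarrow> real"
  assumes "\<And>v. v \<in> V \<Longrightarrow> x v \<ge> 0" "a > 0" "real (card V) * a \<le> (\<Sum>v\<in>V. x v)"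
  shows "real (card V) * a ^ t \<le> (\<Sum>v\<in>V. x v ^ t)"
proof -
  \<comment> \<open>The tangent to \<open>y ^ t\<close> at \<open>y = a\<close> stays below the
    curve for nonnegative \<open>y\<close>: this is Bernoulli's inequality at
    \<open>x v / a - 1\<close>. Summed over \<open>V\<close>, it gives the power mean
    inequality.\<close>
  have tangent: "a ^ t * (1 + t * (x v / a - 1)) \<le> x v ^ t" if "v \<in> V" for v
  proof -
    have "1 + t * (x v / a - 1) \<le> (1 + (x v / a - 1)) ^ t"
      using assms that by (intro Bernoulli_inequality) simp
    then have "a ^ t * (1 + t * (x v / a - 1)) \<le> a ^ t * (x v / a) ^ t"
      using \<open>a > 0\<close> by (intro mult_left_mono) auto
    also have "\<dots> = x v ^ t"
      using \<open>a > 0\<close> by (simp add: power_divide)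
    finally show ?thesis .
  qed
  have "card V \<le> (\<Sum>v\<in>V. x v) / a"
    using assms(2,3) by (simp add: field_simps)
  \<comment> \<open>The average of \<open>x\<close> is at least \<open>a\<close>, so the linear
    terms of the tangents have a nonnegative sum.\<close>
  then have "card V \<le> card V + t * ((\<Sum>v\<in>V. x v) / a - card V)"
    by simp
  then have "real (card V) * a ^ t \<le> a ^ t * (card V + t * ((\<Sum>v\<in>V. x v) / a - card V))"
    using \<open>a > 0\<close> by (subst mult.commute) (intro mult_left_mono, auto)
  also have "\<dots> = (\<Sum>v\<in>V. a ^ t * (1 + t * (x v / a - 1)))"
    by (simp add: sum_distrib_left[symmetric] sum.distrib sum_subtractf sum_divide_distrib[symmetric])
  also have "\<dots> \<le> (\<Sum>v\<in>V. x v ^ t)"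
    by (intro sum_mono tangent)
  finally show ?thesis .
qed

text \<open>Each edge of colour \<open>k\<close> comes from an ordered pair of adjacent vertices.
  The factor 2 of the handshake identity is given away, as constants do not matter here.\<close>

lemma card_colour_class_le:
  assumes "finite V"
  shows "card (colour_class f V k) \<le> (\<Sum>v\<in>V. card (colour_nbhd f V k v))"
proof -
  have fin: "finite (colour_nbhd f V k v)" for v
    using assms by (simp add: colour_nbhd_def)
  have "colour_class f V k \<subseteq> (\<lambda>(v, u). {v, u}) ` (SIGMA v:V. colour_nbhd f V k v)"
  proof
    fix e assume e: "e \<in> colour_class f V k"
    then obtain v u where "e = {v, u}" "v \<in> V" "u \<in> V" "v \<noteq> u"
      unfolding colour_class_def by (auto elim: nsets2_E)
    with e have "(v, u) \<in> (SIGMA v:V. colour_nbhd f V k v)"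
      by (auto simp: colour_class_def colour_nbhd_def)
    with \<open>e = {v, u}\<close> show "e \<in> (\<lambda>(v, u). {v, u}) ` (SIGMA v:V. colour_nbhd f V k v)"
      by force
  qed
  then have "card (colour_class f V k) \<le> card (SIGMA v:V. colour_nbhd f V k v)"
    using assms fin by (intro surj_card_le) auto
  then show ?thesis
    using assms fin by simp
qed

section \<open>Cliques of both colours and the unavoidable colourings they force\<close>

lemma unavoidable_or_mono_clique:
  assumes "t > 0"
  shows "\<exists>D. \<forall>(V :: 'a set) f k. finite V \<longrightarrow> V \<noteq> {} \<longrightarrow>
     card V ^ t * D \<le> (\<Sum>v\<in>V. card (colour_nbhd f V k v) ^ t) \<longrightarrow>
     contains_unavoidable t V f \<or> (\<exists>X \<subseteq> V. card X = p \<and> mono_clique f k X)"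
proof -
  \<comment> \<open>The number \<open>q\<close> is applied to the set \<open>U\<close> from
    dependent random choice, and \<open>m\<close> below to the common neighbourhood of a
    \<open>t\<close>-clique in \<open>U\<close>. Together they give the witness
    \<open>q + m ^ t\<close> for \<open>D\<close>.\<close>
  obtain q where q: "\<And>(V :: 'a set) f k. finite V \<Longrightarrow> card V \<ge> q \<Longrightarrow>
     (\<exists>A \<subseteq> V. card A = p \<and> mono_clique f k A) \<or>
     (\<exists>A \<subseteq> V. \<exists>j. card A = t \<and> j \<noteq> k \<and> mono_clique f j A)"
    using ramsey_colour[of p t] by blast
  obtain m where m: "\<And>(V :: 'a set) f k. finite V \<Longrightarrow> card V \<ge> m \<Longrightarrow>
     (\<exists>A \<subseteq> V. card A = t \<and> mono_clique f k A) \<or>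
     (\<exists>A \<subseteq> V. \<exists>j. card A = t \<and> j \<noteq> k \<and> mono_clique f j A)"
    using ramsey_colour[of t t] by blast
  have main: "contains_unavoidable t V f \<or> (\<exists>X \<subseteq> V. card X = p \<and> mono_clique f k X)"
    if fin: "finite V" and "V \<noteq> {}"
      and deg: "card V ^ t * (q + m ^ t) \<le> (\<Sum>v\<in>V. card (colour_nbhd f V k v) ^ t)"
    for V :: "'a set" and f k
  proof -
    have "colour_nbhd f V k v \<subseteq> V" for v
      by (auto simp: colour_nbhd_def)
    from dependent_random_choice[OF fin \<open>V \<noteq> {}\<close> assms this deg]
    obtain U where U: "U \<subseteq> V" "card U \<ge> q"
      "\<And>S. S \<subseteq> U \<Longrightarrow> card S = t \<Longrightarrow> card {w \<in> V. \<forall>s\<in>S. w \<in> colour_nbhd f V k s} \<ge> m"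
      by blast
    consider X where "X \<subseteq> U" "card X = p" "mono_clique f k X"
      | A j where "A \<subseteq> U" "card A = t" "j \<noteq> k" "mono_clique f j A"
      using q[of U f k] U(1,2) fin finite_subset by metis
    then show ?thesis
    proof cases
      case 1
      then show ?thesis using U(1) by blast
    next
      case 2
      define W where "W = {w \<in> V. \<forall>s\<in>A. w \<in> colour_nbhd f V k s}"
      have "finite W" "card W \<ge> m"
        unfolding W_def using fin U(3) 2 by simp_all
      then obtain B b where B: "B \<subseteq> W" "card B = t" "mono_clique f b B"
        using m by metis
      \<comment> \<open>No vertex lies in its own \<open>colour_nbhd\<close>, so a common neighbour
        of \<open>A\<close> lies outside \<open>A\<close>.\<close>
      have "A \<inter> B = {}" "mono_between f k A B"
        using B(1) by (auto simp: W_def colour_nbhd_def mono_between_def)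
      moreover have "A \<subseteq> V" "B \<subseteq> V"
        using 2 U(1) B(1) by (auto simp: W_def)
      ultimately have "unavoidable_colouring t (A \<union> B) f"
        using 2 B fin finite_subset by (intro unavoidable_colouring_Un[of _ _ _ _ j b k]) auto
      moreover have "A \<union> B \<subseteq> V"
        using \<open>A \<subseteq> V\<close> \<open>B \<subseteq> V\<close> by simp
      ultimately show ?thesis
        unfolding contains_unavoidable_def by metis
    qed
  qed
  show ?thesis by (intro exI[of _ "q + m ^ t"] allI impI main)
qed

text \<open>A red and a blue clique share at most one vertex, since an edge inside both would have
  both colours. Removing that vertex makes them disjoint, and \<open>bipartite_ramsey\<close> then
  finds the two sides to glue. Hence the witness \<open>Suc N\<close> for \<open>p\<close>.\<close>

lemma mono_cliques_imp_unavoidable: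
  "\<exists>p. \<forall>(V :: 'a set) f X Y. finite V \<longrightarrow> X \<subseteq> V \<longrightarrow> Y \<subseteq> V \<longrightarrow> card X = p \<longrightarrow> card Y = p \<longrightarrow>
     mono_clique f Red X \<longrightarrow> mono_clique f Blue Y \<longrightarrow> contains_unavoidable t V f"
proof -
  obtain N where N: "\<And>(X :: 'a set) Y f. finite X \<Longrightarrow> finite Y \<Longrightarrow> card X \<ge> N \<Longrightarrow> card Y \<ge> N \<Longrightarrow>
     \<exists>A \<subseteq> X. \<exists>B \<subseteq> Y. \<exists>c. card A = t \<and> card B = t \<and> mono_between f c A B"
    using bipartite_ramsey[of t] by blast
  have "contains_unavoidable t V f"
    if "finite V" "X \<subseteq> V" "Y \<subseteq> V" "card X = Suc N" "card Y = Suc N"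
      and X: "mono_clique f Red X" and Y: "mono_clique f Blue Y"
    for V :: "'a set" and f X Y
  proof -
    have fin: "finite X" "finite Y"
      using that finite_subset by blast+
    have "x = y" if "x \<in> X \<inter> Y" "y \<in> X \<inter> Y" for x y
    proof (rule ccontr)
      assume "x \<noteq> y"
      then have "f {x, y} = Red" "f {x, y} = Blue"
        using that by (auto intro: mono_cliqueD[OF X] mono_cliqueD[OF Y])
      then show False by simp
    qed
    then have "card (X \<inter> Y) \<le> 1"
      using card_le_Suc0_iff_eq[of "X \<inter> Y"] fin(1) by simp
    then have "card (X - Y) \<ge> N"
      using fin \<open>card X = Suc N\<close> by (simp add: card_Diff_subset_Int)
    moreover have "finite (X - Y)" "card Y \<ge> N"
      using fin(1) \<open>card Y = Suc N\<close> by simp_all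
    ultimately obtain A B c where
      AB: "A \<subseteq> X - Y" "B \<subseteq> Y" "card A = t" "card B = t" "mono_between f c A B"
      using N[of "X - Y" Y f] fin(2) by blast
    have finA: "finite A" and finB: "finite B"
      using AB(1,2) fin by (meson finite_subset finite_Diff)+
    have "mono_clique f Red A" "mono_clique f Blue B"
      using AB(1,2) X Y by (auto intro: mono_clique_subset)
    \<comment> \<open>Whatever the colour between the sides, it differs from that of one of the two
      cliques.\<close>
    moreover have "Red \<noteq> c \<or> Blue \<noteq> c"
      by (cases c) auto
    ultimately have "unavoidable_colouring t (A \<union> B) f"
      using AB finA finB by (intro unavoidable_colouring_Un[of _ _ _ _ Red Blue c]) auto
    moreover have "A \<union> B \<subseteq> V"
      using AB that by blast
    ultimately show ?thesis
      unfolding contains_unavoidable_def by blast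
  qed
  then show ?thesis by blast
qed

text \<open>This is where the exponent \<open>1 / t\<close> enters. The average degree in colour
  \<open>k\<close> is at least \<open>a\<close>, which is \<open>C\<close> times \<open>n\<close> to
  the power \<open>1 - 1 / t\<close>. Hence the \<open>t\<close>-th powers of the degrees sum to at
  least \<open>n * a ^ t = C ^ t * n ^ t\<close>, the order of magnitude that dependent random
  choice asks for.\<close>

lemma far_from_monochromatic_imp_degree_sum:
  fixes C :: real and D :: nat
  assumes fin: "finite V" and ne: "V \<noteq> {}" and t: "t > 0" and C: "C \<ge> 1" "C \<ge> real D"
    and far: "far_from_monochromatic (C * real (card V) powr (- (1 / real t))) V f"
  shows "card V ^ t * D \<le> (\<Sum>v\<in>V. card (colour_nbhd f V k v) ^ t)"
proof -
  define n where "n = real (card V)"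
  have n: "n > 0"
    using fin ne by (simp add: n_def card_gt_0_iff)
  define a where "a = C * n powr (- (1 / real t)) * n"
  have "a > 0"
    using n C by (simp add: a_def)
  have "n * a \<le> card (colour_class f V k)"
    using far by (simp add: far_from_monochromatic_def a_def n_def power2_eq_square algebra_simps)
  also have "\<dots> \<le> (\<Sum>v\<in>V. real (card (colour_nbhd f V k v)))"
    using card_colour_class_le[OF fin, of f k] by (metis of_nat_le_iff of_nat_sum)
  finally have "n * a ^ t \<le> (\<Sum>v\<in>V. real (card (colour_nbhd f V k v)) ^ t)"
    using \<open>a > 0\<close> unfolding n_def by (intro sum_power_ge) auto
  moreover have "n * a ^ t = C ^ t * n ^ t"
  proof -
    have "(n powr (- (1 / real t))) ^ t = n powr (- 1)"
      using n t by (simp add: powr_power)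
    then show ?thesis
      using n by (simp add: a_def power_mult_distrib powr_minus)
  qed
  moreover have "n ^ t * D \<le> C ^ t * n ^ t"
  proof -
    \<comment> \<open>Since \<open>C \<ge> 1\<close> and \<open>t > 0\<close>, \<open>C ^ t\<close>
      is at least \<open>C\<close>, which is at least \<open>D\<close>.\<close>
    have "real D \<le> C ^ t"
      using C self_le_power[of C t] t by linarith
    then show ?thesis
      using n by (simp add: mult.commute)
  qed
  ultimately have "real (card V ^ t * D) \<le> real (\<Sum>v\<in>V. card (colour_nbhd f V k v) ^ t)"
    by (simp add: n_def)
  then show ?thesis
    by (simp only: of_nat_le_iff)
qed

theorem theorem1p1:
  fixes t :: nat
  assumes "t \<ge> 3"
  shows "\<exists>C::real. C > 0 \<and>
           (\<forall>n::nat. real n \<ge> C \<longrightarrow>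
              (\<forall>f :: nat set \<Rightarrow> colour.
                 far_from_monochromatic (C * real n powr (- (1 / real t))) {..<n} f \<longrightarrow>
                 contains_unavoidable t {..<n} f))"
proof -
  have t: "t > 0" using assms by simp
  obtain p where p: "\<And>(V :: nat set) f X Y. finite V \<Longrightarrow> X \<subseteq> V \<Longrightarrow> Y \<subseteq> V \<Longrightarrow> card X = p \<Longrightarrow>
      card Y = p \<Longrightarrow> mono_clique f Red X \<Longrightarrow> mono_clique f Blue Y \<Longrightarrow> contains_unavoidable t V f"
    using mono_cliques_imp_unavoidable[of t] by blast
  obtain D where D: "\<And>(V :: nat set) f k. finite V \<Longrightarrow> V \<noteq> {} \<Longrightarrow>
     card V ^ t * D \<le> (\<Sum>v\<in>V. card (colour_nbhd f V k v) ^ t) \<Longrightarrow>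
     contains_unavoidable t V f \<or> (\<exists>X \<subseteq> V. card X = p \<and> mono_clique f k X)"
    using unavoidable_or_mono_clique[OF t, of p] by blast
  \<comment> \<open>\<open>D\<close> depends on the clique size \<open>p\<close>, hence the order of
    choice. Adding 1 ensures \<open>C \<ge> 1\<close>, which also makes \<open>n\<close>
    positive.\<close>
  define C where "C = real D + 1"
  have "contains_unavoidable t {..<n} f"
    if "real n \<ge> C" and far: "far_from_monochromatic (C * real n powr (- (1 / real t))) {..<n} f"
    for n :: nat and f :: "nat set \<Rightarrow> colour"
  proof -
    have "n > 0"
      using that(1) by (cases n) (auto simp: C_def)
    then have "card {..<n} ^ t * D \<le> (\<Sum>v<n. card (colour_nbhd f {..<n} k v) ^ t)" for k
      using far t by (intro far_from_monochromatic_imp_degree_sum[of _ _ C]) (auto simp: C_def)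
    \<comment> \<open>The colour \<open>k\<close> is arbitrary: instances for \<open>Red\<close> and
      for \<open>Blue\<close> give either the claim or both of the cliques that \<open>p\<close>
      needs.\<close>
    then have "contains_unavoidable t {..<n} f \<or> (\<exists>X \<subseteq> {..<n}. card X = p \<and> mono_clique f k X)" for k
      using D[of "{..<n}" f k] \<open>n > 0\<close> by auto
    then show ?thesis
      using p[of "{..<n}" _ _ f] by (metis finite_lessThan)
  qed
  moreover have "C > 0" by (simp add: C_def)
  ultimately show ?thesis by blast
qed

end
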